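(* All continued Type I Darboux transformations are invertible.
   Context: $K$ is a differential field of characteristic zero with commuting derivations $\partial_t,\partial_{x_1},\dots,\partial_{x_n}$, and $K[\partial_t,\partial_{x_1},\dots,\partial_{x_n}]$ is the ring of linear partial differential operators over $K$. $\sigma(L)$ denotes the principal symbol of $L$. A Darboux transformation $(M,N)\colon L\to L_1$, where $\sigma(L)=\sigma(L_1)$, is a pair of operators $(M,N)$ satisfying $NL=L_1M$. A continued Type I Darboux transformation is a Darboux transformation $(M,N)\colon L\to L_1$ arising as follows: for some $k\ge1$ there are nonzero operators $A_1,\dots,A_k$, $M=M_1,M_2,\dots,M_k\in K[\partial_t,\partial_{x_1},\dots,\partial_{x_n}]$ and a nonzero $f=M_{k+1}\in K$ with $M_{i-1}=A_iM_i+M_{i+1}$ for $1\le i\le k$, where $M_0=L$; one sets $N_{k+1}=f$, $N_k=fM_kf^{-1}$, $N_i=N_{i+1}A_{i+1}+N_{i+2}$ for $0\le i\le k-1$ (downward recursion), and $N=N_1$, $L_1=N_0$. A Darboux transformation $(M,N)\colon L\to L_1$ is invertible if there exist a Darboux transformation $(M',N')\colon L_1\to L$ and operators $A,B\in K[\partial_t,\partial_{x_1},\dots,\partial_{x_n}]$ with $M'M=1+AL$, $N'N=1+LA$, $MM'=1+BL_1$, $NN'=1+L_1B$. *)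

theory Defs
  imports "HOL-Library.Poly_Mapping" "HOL-Library.Function_Algebras"
begin

text \<open>
  The derivations are indexed by a finite type \<open>'i\<close>, which plays the role of the
  \<open>n + 1\<close> labels \<open>t, x\<^sub>1, \<dots>, x\<^sub>n\<close>.
\<close>

locale differential_field =
  fixes D :: "'i::finite \<Rightarrow> 'a::field_char_0 \<Rightarrow> 'a"
  assumes deriv_add: "D i (a + b) = D i a + D i b"
    and deriv_mult: "D i (a * b) = D i a * b + a * D i b"
    and deriv_commute: "D i (D j a) = D j (D i a)"

text \<open>
  A differential operator is given by its finitely many nonzero coefficients:
  \<open>P\<close> stands for the sum of \<open>lookup P \<alpha> \<cdot> \<partial>\<^sup>\<alpha>\<close> over multi-indices \<open>\<alpha>\<close>. Operators are formal, since
  the derivations of the field may be linearly dependent or even zero. Addition, \<open>0\<close> and \<open>1\<close>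
  are those of the type of finitely supported functions, but its multiplication \<open>*\<close> is that of
  commutative polynomials; composition of operators is \<open>pdo_mult\<close> below.
\<close>

type_synonym ('i, 'a) pdo = "('i \<Rightarrow> nat) \<Rightarrow>\<^sub>0 'a"

definition pdo_const :: "'a::zero \<Rightarrow> ('i, 'a) pdo" where
  "pdo_const a = Poly_Mapping.single 0 a"

text \<open>
  Left multiplication by \<open>\<partial>\<^sub>i\<close>, from the rule \<open>\<partial>\<^sub>i b = b \<partial>\<^sub>i + \<partial>\<^sub>i(b)\<close>.
\<close>

definition pdo_deriv_left ::
  "('i \<Rightarrow> 'a \<Rightarrow> 'a) \<Rightarrow> 'i \<Rightarrow> ('i, 'a::field_char_0) pdo \<Rightarrow> ('i, 'a) pdo" where
  "pdo_deriv_left D i Q =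
     (\<Sum>\<beta>\<in>Poly_Mapping.keys Q.
        Poly_Mapping.single (\<beta>(i := Suc (\<beta> i))) (Poly_Mapping.lookup Q \<beta>)
        + Poly_Mapping.single \<beta> (D i (Poly_Mapping.lookup Q \<beta>)))"

text \<open>
  The inner fold is \<open>\<partial>\<^sup>\<alpha> Q\<close>. It does not depend on the order in which the indices are visited,
  because the derivations commute.
\<close>

definition pdo_mult ::
  "('i::finite \<Rightarrow> 'a \<Rightarrow> 'a) \<Rightarrow> ('i, 'a::field_char_0) pdo \<Rightarrow> ('i, 'a) pdo \<Rightarrow> ('i, 'a) pdo" where
  "pdo_mult D P Q =
     (\<Sum>\<alpha>\<in>Poly_Mapping.keys P. Poly_Mapping.map ((*) (Poly_Mapping.lookup P \<alpha>))
        (Finite_Set.fold (\<lambda>i. pdo_deriv_left D i ^^ \<alpha> i) Q UNIV))"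

abbreviation pdo_mult_infix ::
  "('i, 'a) pdo \<Rightarrow> ('i::finite \<Rightarrow> 'a \<Rightarrow> 'a) \<Rightarrow> ('i, 'a::field_char_0) pdo \<Rightarrow> ('i, 'a) pdo"
  ("(_ \<star>\<^bsub>_\<^esub>/ _)" [70, 0, 71] 70) where
  "P \<star>\<^bsub>D\<^esub> Q \<equiv> pdo_mult D P Q"

definition pdo_order :: "('i::finite, 'a::zero) pdo \<Rightarrow> nat" where
  "pdo_order P = Max ((\<lambda>\<alpha>. \<Sum>i\<in>UNIV. \<alpha> i) ` Poly_Mapping.keys P)"

text \<open>
  The top-order part, read as a commutative polynomial. For \<open>P = 0\<close> the order is unspecified,
  but the sum is empty and the symbol is \<open>0\<close>.
\<close>

definition principal_symbol ::
  "('i::finite, 'a::comm_monoid_add) pdo \<Rightarrow> ('i \<Rightarrow> nat) \<Rightarrow>\<^sub>0 'a" where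
  "principal_symbol P =
     (\<Sum>\<alpha> | \<alpha> \<in> Poly_Mapping.keys P \<and> (\<Sum>i\<in>UNIV. \<alpha> i) = pdo_order P.
        Poly_Mapping.single \<alpha> (Poly_Mapping.lookup P \<alpha>))"

text \<open>\<open>darboux D M N L L1\<close> means that \<open>(M, N)\<close> is a Darboux transformation \<open>L \<rightarrow> L1\<close>.\<close>

definition darboux ::
  "('i::finite \<Rightarrow> 'a \<Rightarrow> 'a) \<Rightarrow> ('i, 'a::field_char_0) pdo \<Rightarrow> ('i, 'a) pdo
     \<Rightarrow> ('i, 'a) pdo \<Rightarrow> ('i, 'a) pdo \<Rightarrow> bool" where
  "darboux D M N L L1 \<longleftrightarrow>
     principal_symbol L = principal_symbol L1 \<and> N \<star>\<^bsub>D\<^esub> L = L1 \<star>\<^bsub>D\<^esub> M"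

definition continued_type_I ::
  "('i::finite \<Rightarrow> 'a \<Rightarrow> 'a) \<Rightarrow> ('i, 'a::field_char_0) pdo \<Rightarrow> ('i, 'a) pdo
     \<Rightarrow> ('i, 'a) pdo \<Rightarrow> ('i, 'a) pdo \<Rightarrow> bool" where
  "continued_type_I D M N L L1 \<longleftrightarrow>
     darboux D M N L L1 \<and>
     (\<exists>k\<ge>1. \<exists>(A :: nat \<Rightarrow> ('i, 'a) pdo) (Ms :: nat \<Rightarrow> ('i, 'a) pdo) (Ns :: nat \<Rightarrow> ('i, 'a) pdo) f.
        (\<forall>i\<in>{1..k}. A i \<noteq> 0 \<and> Ms i \<noteq> 0) \<and> f \<noteq> 0 \<and>
        Ms 0 = L \<and> Ms 1 = M \<and> Ms (k + 1) = pdo_const f \<and>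
        (\<forall>i\<in>{1..k}. Ms (i - 1) = A i \<star>\<^bsub>D\<^esub> Ms i + Ms (i + 1)) \<and>
        Ns (k + 1) = pdo_const f \<and>
        Ns k = pdo_const f \<star>\<^bsub>D\<^esub> Ms k \<star>\<^bsub>D\<^esub> pdo_const (inverse f) \<and>
        (\<forall>i<k. Ns i = Ns (i + 1) \<star>\<^bsub>D\<^esub> A (i + 1) + Ns (i + 2)) \<and>
        N = Ns 1 \<and> L1 = Ns 0)"

definition darboux_invertible ::
  "('i::finite \<Rightarrow> 'a \<Rightarrow> 'a) \<Rightarrow> ('i, 'a::field_char_0) pdo \<Rightarrow> ('i, 'a) pdo
     \<Rightarrow> ('i, 'a) pdo \<Rightarrow> ('i, 'a) pdo \<Rightarrow> bool" where
  "darboux_invertible D M N L L1 \<longleftrightarrow>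
     (\<exists>M' N' A B. darboux D M' N' L1 L \<and>
        M' \<star>\<^bsub>D\<^esub> M = 1 + A \<star>\<^bsub>D\<^esub> L \<and> N' \<star>\<^bsub>D\<^esub> N = 1 + L \<star>\<^bsub>D\<^esub> A \<and>
        M \<star>\<^bsub>D\<^esub> M' = 1 + B \<star>\<^bsub>D\<^esub> L1 \<and> N \<star>\<^bsub>D\<^esub> N' = 1 + L1 \<star>\<^bsub>D\<^esub> B)"

end

theory Submission imports Defs begin

text \<open>
  A continued Type I transformation comes from a Euclidean chain
  \<open>M\<^bsub>i-1\<^esub> = A\<^sub>i M\<^sub>i + M\<^bsub>i+1\<^esub>\<close> ending in a unit \<open>f\<close>. In matrix form, the column \<open>(M\<^bsub>i-1\<^esub>, M\<^sub>i)\<close>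
  is obtained from the column \<open>(M\<^sub>i, M\<^bsub>i+1\<^esub>)\<close> by the invertible matrix with rows \<open>(A\<^sub>i, 1)\<close>
  and \<open>(1, 0)\<close>, and the row \<open>(N\<^bsub>i-1\<^esub>, N\<^sub>i)\<close> from the row \<open>(N\<^sub>i, N\<^bsub>i+1\<^esub>)\<close> by the same matrix. At the
  unit end, the column \<open>(M\<^sub>k, f)\<close> and the row \<open>(f, - N\<^sub>k)\<close> fit into a pair of mutually inverse
  \<open>2 \<times> 2\<close> matrices, as first column of the one and last row of the other. Multiplying by the
  elementary matrices and their inverses, and adjusting signs, carries this pair up the
  chain to \<open>(L, M)\<close> and \<open>(N, - L\<^sub>1)\<close>
  (lemmas \<open>unimodular_completion_last\<close>, \<open>unimodular_completion_step\<close> and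
  \<open>euclidean_chain_completion\<close>). There the matrix \<open>X\<close> with rows \<open>(a, b)\<close>, \<open>(N, - L\<^sub>1)\<close> is inverse to
  the matrix \<open>Y\<close> with rows \<open>(L, c)\<close>, \<open>(M, - d)\<close>, and the entries of \<open>X Y = 1\<close> and \<open>Y X = 1\<close> say that
  \<open>M' = b\<close>, \<open>N' = c\<close> is an inverse transformation with \<open>A = - a\<close> and \<open>B = - d\<close>: for example, the
  upper left entry \<open>a L + b M = 1\<close> of \<open>X Y\<close> is \<open>M' M = 1 + A L\<close>, and the upper right entry of \<open>Y X\<close>
  gives the intertwining relation \<open>L b = c L\<^sub>1\<close>. The symbols agree since those of \<open>L\<close> and \<open>L\<^sub>1\<close> do.

  This argument takes place in any ring, so what remains is that differential operators form one.
  Associativity is the substantial axiom. Left multiplication by a coefficient and by \<open>\<partial>\<^sub>i\<close> generate all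
  left multiplications, so it is enough that \<open>P \<mapsto> P \<star> Q\<close> commutes with these two; for \<open>\<partial>\<^sub>i\<close> this is the
  Leibniz rule \<open>\<partial>\<^sub>i c = c \<partial>\<^sub>i + \<partial>\<^sub>i(c)\<close> together with \<open>\<partial>\<^sub>i \<partial>\<^sup>\<alpha> = \<partial>\<^bsup>\<alpha> + e\<^sub>i\<^esup>\<close>, where commutation of the
  derivations enters.
\<close>

section \<open>Euclidean chains in a noncommutative ring\<close>

context ring_1
begin

text \<open>
  The eight equations state that the matrix with rows \<open>(a, b)\<close>, \<open>(n', - n)\<close> and the matrix with rows
  \<open>(m, c)\<close>, \<open>(m', - d)\<close> are inverse to each other: the first four are one product, the last four the
  other. Over a general noncommutative ring neither product determines the other.
\<close>

definition unimodular_completion :: "'a \<Rightarrow> 'a \<Rightarrow> 'a \<Rightarrow> 'a \<Rightarrow> 'a \<Rightarrow> 'a \<Rightarrow> 'a \<Rightarrow> 'a \<Rightarrow> bool" where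
  "unimodular_completion m m' n n' a b c d \<longleftrightarrow>
     a * m + b * m' = 1 \<and> a * c = b * d \<and> n' * m = n * m' \<and> n' * c + n * d = 1 \<and>
     m * a + c * n' = 1 \<and> m * b = c * n \<and> m' * a = d * n' \<and> m' * b + d * n = 1"

lemma unimodular_completion_last:
  assumes "f * g = 1" "g * f = 1"
  shows "unimodular_completion m f (f * m * g) f 0 g g 0"
proof -
  have "g * (f * (m * g)) = m * g"
    by (metis assms(2) mult_assoc mult_1_left)
  moreover have "m * (g * f) = m"
    by (simp add: assms)
  ultimately show ?thesis
    by (simp add: unimodular_completion_def assms mult_assoc)
qed

text \<open>
  The first matrix is multiplied on the right by the inverse of the matrix with rows \<open>(q, 1)\<close>,
  \<open>(1, 0)\<close>, the second one on the left by that matrix; then the last row of the first and the last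
  column of the second change sign, which restores the shape \<open>(n', - n)\<close>.
\<close>

lemma unimodular_completion_step:
  assumes "unimodular_completion m m' n n' a b c d"
  shows "unimodular_completion (q * m + m') m (n * q + n') n b (a - b * q) (d - q * c) c"
proof -
  note eqs = assms[unfolded unimodular_completion_def]
  have 1: "m * a = 1 - c * n'" "m' * b = 1 - d * n" "a * m = 1 - b * m'" "n' * c = 1 - n * d"
    using eqs by (simp_all add: eq_diff_eq)
  have 2: "m * b = c * n" "a * c = b * d" "n' * m = n * m'" "m' * a = d * n'"
    using eqs by simp_all
  note 3 = 1 2
  \<comment> \<open>The relations \<open>x y = w\<close> must also rewrite inside right-nested products.\<close>
  have 4: "x * (y * z) = w * z" if "x * y = w" for x y z w
    using that by (simp add: mult_assoc [symmetric])
  show ?thesis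
    unfolding unimodular_completion_def
    by (simp add: algebra_simps 3 3[THEN 4])
qed

lemma euclidean_chain_completion:
  assumes unit: "f * g = 1" "g * f = 1"
    and M: "M (Suc k) = f" "\<And>i. i < k \<Longrightarrow> M i = A (Suc i) * M (Suc i) + M (Suc (Suc i))"
    and N: "N (Suc k) = f" "N k = f * M k * g"
      "\<And>i. i < k \<Longrightarrow> N i = N (Suc i) * A (Suc i) + N (Suc (Suc i))"
  shows "\<exists>a b c d. unimodular_completion (M 0) (M 1) (N 0) (N 1) a b c d"
proof -
  have "\<exists>a b c d. unimodular_completion (M 0) (M (Suc 0)) (N 0) (N (Suc 0)) a b c d"
  proof (induction rule: inc_induct[OF le0[of k]])
    case 1
    show ?case
      unfolding M(1) N(1) N(2) using unimodular_completion_last[OF unit] by blast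
  next
    case (2 i)
    then show ?case
      unfolding M(2)[OF \<open>i < k\<close>] N(3)[OF \<open>i < k\<close>] using unimodular_completion_step by blast
  qed
  then show ?thesis by simp
qed

end

section \<open>The ring of differential operators\<close>

lemma multi_index_induct [case_names zero Suc]:
  fixes \<alpha> :: "'i::finite \<Rightarrow> nat"
  assumes zero: "P 0" and Suc: "\<And>\<alpha> i. P \<alpha> \<Longrightarrow> P (\<alpha>(i := Suc (\<alpha> i)))"
  shows "P \<alpha>"
proof (induction "\<Sum>i\<in>UNIV. \<alpha> i" arbitrary: \<alpha> rule: less_induct)
  case less
  show ?case
  proof (cases "\<alpha> = 0")
    case False
    then obtain i where i: "\<alpha> i \<noteq> 0"
      by (auto simp: fun_eq_iff)
    let ?\<beta> = "\<alpha>(i := \<alpha> i - 1)"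
    have "(\<Sum>j\<in>UNIV. ?\<beta> j) < (\<Sum>j\<in>UNIV. \<alpha> j)"
      using i by (intro sum_strict_mono_ex1) auto
    then have "P (?\<beta>(i := Suc (?\<beta> i)))"
      by (intro Suc less)
    then show ?thesis
      using i by simp
  qed (simp add: zero)
qed

text \<open>
  Scaling all coefficients from the left is multiplication by a constant in the commutative polynomial
  ring on the same type. The ring laws of that multiplication then take care of scalars.
\<close>

lemma lookup_const_times:
  fixes Q :: "('i, 'a::field_char_0) pdo"
  shows "Poly_Mapping.lookup (pdo_const c * Q) \<gamma> = c * Poly_Mapping.lookup Q \<gamma>"
  by (auto simp: pdo_const_def mult_map_scale_conv_mult [symmetric] Poly_Mapping.map.rep_eq when_def)

context differential_field
begin

lemma deriv_zero: "D i 0 = 0"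
  using deriv_add[of i 0 0] by simp

lemma deriv_one: "D i 1 = 0"
  using deriv_mult[of i 1 1] by simp

abbreviation deriv_left :: "'i \<Rightarrow> ('i, 'a) pdo \<Rightarrow> ('i, 'a) pdo" ("\<partial>") where
  "\<partial> \<equiv> pdo_deriv_left D"

definition deriv_pow :: "('i \<Rightarrow> nat) \<Rightarrow> ('i, 'a) pdo \<Rightarrow> ('i, 'a) pdo" where
  "deriv_pow \<alpha> Q = Finite_Set.fold (\<lambda>i. \<partial> i ^^ \<alpha> i) Q UNIV"

lemma shift_eq_iff:
  "\<beta>(i := Suc (\<beta> i)) = \<gamma> \<longleftrightarrow> \<gamma> i \<noteq> 0 \<and> \<beta> = \<gamma>(i := \<gamma> i - 1)" for \<gamma> :: "'i \<Rightarrow> nat"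
  by (auto simp: fun_eq_iff)

text \<open>
  This formula has no sum over the support of \<open>Q\<close>, so identities between operators built from \<open>\<partial> i\<close>
  can be checked coefficient by coefficient.
\<close>

lemma lookup_deriv_left:
  "Poly_Mapping.lookup (\<partial> i Q) \<gamma> =
     (if \<gamma> i = 0 then 0 else Poly_Mapping.lookup Q (\<gamma>(i := \<gamma> i - 1)))
     + D i (Poly_Mapping.lookup Q \<gamma>)"
proof -
  have "Poly_Mapping.lookup (\<partial> i Q) \<gamma> =
      (\<Sum>\<beta>\<in>Poly_Mapping.keys Q.
         if \<gamma> i \<noteq> 0 \<and> \<beta> = \<gamma>(i := \<gamma> i - 1) then Poly_Mapping.lookup Q \<beta> else 0)
      + (\<Sum>\<beta>\<in>Poly_Mapping.keys Q. if \<beta> = \<gamma> then D i (Poly_Mapping.lookup Q \<beta>) else 0)"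
    unfolding pdo_deriv_left_def lookup_sum lookup_add lookup_single shift_eq_iff when_def
    by (simp add: sum.distrib)
  also have "\<dots> = (if \<gamma> i = 0 then 0 else Poly_Mapping.lookup Q (\<gamma>(i := \<gamma> i - 1)))
     + D i (Poly_Mapping.lookup Q \<gamma>)"
    by (cases "\<gamma> i = 0") (auto simp: in_keys_iff deriv_zero)
  finally show ?thesis .
qed

lemma deriv_left_add: "\<partial> i (P + Q) = \<partial> i P + \<partial> i Q"
  by (rule poly_mapping_eqI) (simp add: lookup_deriv_left lookup_add deriv_add)

text \<open>
  The Leibniz rule for the composition of \<open>\<partial>\<^sub>i\<close> with a multiplication operator.
\<close>

lemma deriv_left_const_times:
  "\<partial> i (pdo_const c * Q) = pdo_const (D i c) * Q + pdo_const c * \<partial> i Q"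
  by (rule poly_mapping_eqI)
    (simp add: lookup_deriv_left lookup_add lookup_const_times deriv_mult distrib_left add_ac)

lemma deriv_left_single:
  "\<partial> i (Poly_Mapping.single \<beta> b) =
     Poly_Mapping.single (\<beta>(i := Suc (\<beta> i))) b + Poly_Mapping.single \<beta> (D i b)"
  by (cases "b = 0") (simp_all add: pdo_deriv_left_def deriv_zero)

lemma deriv_left_commute: "\<partial> i (\<partial> j Q) = \<partial> j (\<partial> i Q)"
proof (cases "i = j")
  case False
  then show ?thesis
    by (intro poly_mapping_eqI)
      (auto simp: lookup_deriv_left deriv_add deriv_zero deriv_commute[of i j] fun_upd_twist)
qed simp

lemma deriv_left_pow_commute: "comp_fun_commute (\<lambda>i. \<partial> i ^^ \<alpha> i)"
proof -
  interpret comp_fun_commute \<partial>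
    by standard (simp add: fun_eq_iff deriv_left_commute)
  show ?thesis
    by (rule comp_fun_commute_funpow)
qed

lemma deriv_pow_zero: "deriv_pow 0 Q = Q"
proof -
  interpret comp_fun_commute "\<lambda>(_ :: 'i) (X :: ('i, 'a) pdo). X"
    by standard simp
  have "Finite_Set.fold (\<lambda>_ X. X) Q A = Q" if "finite A" for A :: "'i set"
    using that by induction simp_all
  then show ?thesis
    by (simp add: deriv_pow_def id_def)
qed

text \<open>
  As the operators \<open>\<partial> i\<close> commute, the index \<open>i\<close> may be visited last in the fold, and the remaining
  indices contribute the same to both sides. With \<open>deriv_pow_zero\<close>, this determines \<open>deriv_pow\<close> by
  recursion on the multi-index, without further reference to the fold.
\<close>

lemma deriv_pow_Suc: "deriv_pow (\<alpha>(i := Suc (\<alpha> i))) Q = \<partial> i (deriv_pow \<alpha> Q)"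
proof -
  let ?\<alpha>' = "\<alpha>(i := Suc (\<alpha> i))"
  interpret a: comp_fun_commute "\<lambda>j. \<partial> j ^^ \<alpha> j"
    by (rule deriv_left_pow_commute)
  interpret b: comp_fun_commute "\<lambda>j. \<partial> j ^^ ?\<alpha>' j"
    by (rule deriv_left_pow_commute)
  have rest: "Finite_Set.fold (\<lambda>j. \<partial> j ^^ ?\<alpha>' j) Q (UNIV - {i})
      = Finite_Set.fold (\<lambda>j. \<partial> j ^^ \<alpha> j) Q (UNIV - {i})"
    by (rule Finite_Set.fold_cong[where S = UNIV])
      (use deriv_left_pow_commute in \<open>auto simp: comp_fun_commute_def'\<close>)
  have "deriv_pow ?\<alpha>' Q = (\<partial> i ^^ Suc (\<alpha> i)) (Finite_Set.fold (\<lambda>j. \<partial> j ^^ \<alpha> j) Q (UNIV - {i}))"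
    using b.fold_rec[of UNIV i Q] rest by (simp add: deriv_pow_def)
  also have "\<dots> = \<partial> i (deriv_pow \<alpha> Q)"
    using a.fold_rec[of UNIV i Q] by (simp add: deriv_pow_def)
  finally show ?thesis .
qed

lemma deriv_pow_add: "deriv_pow \<alpha> (P + Q) = deriv_pow \<alpha> P + deriv_pow \<alpha> Q"
  by (induction \<alpha> rule: multi_index_induct)
    (simp_all del: fun_upd_apply zero_fun_apply
      add: deriv_pow_zero deriv_pow_Suc deriv_left_add)

lemma deriv_pow_one: "deriv_pow \<alpha> 1 = Poly_Mapping.single \<alpha> 1"
  by (induction \<alpha> rule: multi_index_induct)
    (simp_all del: fun_upd_apply zero_fun_apply
      add: deriv_pow_zero deriv_pow_Suc deriv_left_single deriv_one)

text \<open>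
  Enlarging the index set makes operators with different supports comparable, as needed for additivity.
\<close>

lemma mult_superset:
  assumes "finite S" "Poly_Mapping.keys P \<subseteq> S"
  shows "P \<star>\<^bsub>D\<^esub> Q = (\<Sum>\<alpha>\<in>S. pdo_const (Poly_Mapping.lookup P \<alpha>) * deriv_pow \<alpha> Q)"
  unfolding pdo_mult_def deriv_pow_def mult_map_scale_conv_mult pdo_const_def
  using assms by (intro sum.mono_neutral_left) (auto simp: in_keys_iff)

lemma mult_add_left: "(P + P') \<star>\<^bsub>D\<^esub> Q = P \<star>\<^bsub>D\<^esub> Q + P' \<star>\<^bsub>D\<^esub> Q"
proof -
  let ?S = "Poly_Mapping.keys P \<union> Poly_Mapping.keys P'"
  have "finite ?S" "Poly_Mapping.keys (P + P') \<subseteq> ?S"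
    using Poly_Mapping.keys_add[of P P'] by auto
  then show ?thesis
    by (simp add: mult_superset[of ?S] lookup_add pdo_const_def single_add distrib_right sum.distrib)
qed

lemma mult_add_right: "P \<star>\<^bsub>D\<^esub> (Q + Q') = P \<star>\<^bsub>D\<^esub> Q + P \<star>\<^bsub>D\<^esub> Q'"
  by (simp add: mult_superset[OF finite_keys order_refl] deriv_pow_add distrib_left sum.distrib)

lemma mult_single: "Poly_Mapping.single \<alpha> c \<star>\<^bsub>D\<^esub> Q = pdo_const c * deriv_pow \<alpha> Q"
  by (subst mult_superset[of "{\<alpha>}"]) auto

lemma pdo_additive_induct [case_names single add]:
  fixes P :: "('i, 'a) pdo"
  assumes single: "\<And>\<alpha> c. R (Poly_Mapping.single \<alpha> c)" and add: "\<And>P Q. R P \<Longrightarrow> R Q \<Longrightarrow> R (P + Q)"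
  shows "R P"
proof -
  have "R (\<Sum>\<alpha>\<in>A. Poly_Mapping.single \<alpha> (Poly_Mapping.lookup P \<alpha>))" if "finite A" for A
    using that
  proof induction
    case empty
    show ?case using single[of 0 0] by simp
  qed (simp add: single add)
  moreover have "(\<Sum>\<alpha>\<in>Poly_Mapping.keys P. Poly_Mapping.single \<alpha> (Poly_Mapping.lookup P \<alpha>)) = P"
    by (rule poly_mapping_eqI) (auto simp: lookup_sum lookup_single when_def in_keys_iff)
  ultimately show ?thesis
    using finite_keys by metis
qed

lemma mult_const_times_left: "(pdo_const c * P) \<star>\<^bsub>D\<^esub> Q = pdo_const c * (P \<star>\<^bsub>D\<^esub> Q)"
proof (induction P rule: pdo_additive_induct)
  case (single \<alpha> b)
  then show ?case
    by (simp add: pdo_const_def Poly_Mapping.mult_single mult_single mult.assoc [symmetric])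
qed (simp add: mult_add_left distrib_left)

text \<open>
  By additivity it is enough to take for \<open>P\<close> a monomial \<open>b \<partial>\<^sup>\<alpha>\<close>. Both sides are then
  \<open>b \<partial>\<^bsup>\<alpha> + e\<^sub>i\<^esup> Q + \<partial>\<^sub>i(b) \<partial>\<^sup>\<alpha> Q\<close>, by the Leibniz rule.
\<close>

lemma mult_deriv_left: "\<partial> i P \<star>\<^bsub>D\<^esub> Q = \<partial> i (P \<star>\<^bsub>D\<^esub> Q)"
proof (induction P rule: pdo_additive_induct)
  case (single \<alpha> b)
  then show ?case
    by (simp add: deriv_left_single mult_add_left mult_single deriv_left_const_times deriv_pow_Suc)
qed (simp add: mult_add_left deriv_left_add)

lemma mult_deriv_pow_left: "deriv_pow \<alpha> P \<star>\<^bsub>D\<^esub> Q = deriv_pow \<alpha> (P \<star>\<^bsub>D\<^esub> Q)"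
  by (induction \<alpha> rule: multi_index_induct)
    (simp_all del: fun_upd_apply zero_fun_apply
      add: deriv_pow_zero deriv_pow_Suc mult_deriv_left)

lemma mult_assoc: "(P \<star>\<^bsub>D\<^esub> Q) \<star>\<^bsub>D\<^esub> R = P \<star>\<^bsub>D\<^esub> (Q \<star>\<^bsub>D\<^esub> R)"
  by (induction P rule: pdo_additive_induct)
    (simp_all add: mult_single mult_const_times_left mult_deriv_pow_left mult_add_left)

lemma mult_const_left: "pdo_const c \<star>\<^bsub>D\<^esub> Q = pdo_const c * Q"
  by (simp add: pdo_const_def mult_single deriv_pow_zero)

lemma mult_one_left: "1 \<star>\<^bsub>D\<^esub> Q = Q"
  using mult_const_left[of 1] by (simp add: pdo_const_def)

lemma mult_one_right: "P \<star>\<^bsub>D\<^esub> 1 = P"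
  by (induction P rule: pdo_additive_induct)
    (simp_all add: mult_add_left mult_single deriv_pow_one pdo_const_def Poly_Mapping.mult_single)

lemma const_mult_const_inverse:
  assumes "f \<noteq> 0"
  shows "pdo_const f \<star>\<^bsub>D\<^esub> pdo_const (inverse f) = 1" "pdo_const (inverse f) \<star>\<^bsub>D\<^esub> pdo_const f = 1"
  using assms by (simp_all add: mult_const_left) (simp_all add: pdo_const_def Poly_Mapping.mult_single)

lemma pdo_ring_1: "class.ring_1 1 (pdo_mult D) (+) (0 :: ('i, 'a) pdo) (-) uminus"
proof
qed (simp_all add: mult_assoc mult_one_left mult_one_right mult_add_left mult_add_right)

end

section \<open>Invertibility\<close>

theorem theorem5p5:
  fixes D :: "'i::finite \<Rightarrow> 'a::field_char_0 \<Rightarrow> 'a"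
    and M N L L1 :: "('i, 'a) pdo"
  assumes "differential_field D"
    and "continued_type_I D M N L L1"
  shows "darboux_invertible D M N L L1"
proof -
  interpret differential_field D by fact
  interpret pdo: ring_1 1 "pdo_mult D" "(+)" "0 :: ('i, 'a) pdo" "(-)" uminus
    by (rule pdo_ring_1)
  obtain k and A Ms Ns :: "nat \<Rightarrow> ('i, 'a) pdo" and f
    where f: "f \<noteq> 0" and ends: "Ms 0 = L" "Ms 1 = M" "N = Ns 1" "L1 = Ns 0"
    and Ms: "Ms (k + 1) = pdo_const f" "\<forall>i\<in>{1..k}. Ms (i - 1) = A i \<star>\<^bsub>D\<^esub> Ms i + Ms (i + 1)"
    and Ns: "Ns (k + 1) = pdo_const f"
      "Ns k = pdo_const f \<star>\<^bsub>D\<^esub> Ms k \<star>\<^bsub>D\<^esub> pdo_const (inverse f)"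
      "\<forall>i<k. Ns i = Ns (i + 1) \<star>\<^bsub>D\<^esub> A (i + 1) + Ns (i + 2)"
    and symbol: "principal_symbol L = principal_symbol L1"
    using assms(2) unfolding continued_type_I_def darboux_def by blast
  have "Ms i = A (Suc i) \<star>\<^bsub>D\<^esub> Ms (Suc i) + Ms (Suc (Suc i))" if "i < k" for i
    using Ms(2)[rule_format, of "Suc i"] that by simp
  then obtain a b c d where "pdo.unimodular_completion (Ms 0) (Ms 1) (Ns 0) (Ns 1) a b c d"
    using pdo.euclidean_chain_completion[OF const_mult_const_inverse[OF f], of Ms k A Ns] Ms Ns
    by auto
  then have eqs: "a \<star>\<^bsub>D\<^esub> L + b \<star>\<^bsub>D\<^esub> M = 1" "N \<star>\<^bsub>D\<^esub> c + L1 \<star>\<^bsub>D\<^esub> d = 1"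
      "L \<star>\<^bsub>D\<^esub> a + c \<star>\<^bsub>D\<^esub> N = 1" "M \<star>\<^bsub>D\<^esub> b + d \<star>\<^bsub>D\<^esub> L1 = 1" "L \<star>\<^bsub>D\<^esub> b = c \<star>\<^bsub>D\<^esub> L1"
    unfolding pdo.unimodular_completion_def ends by auto
  \<comment> \<open>The inverse transformation is \<open>(b, c)\<close>, with \<open>- a\<close> and \<open>- d\<close> in the roles of \<open>A\<close> and \<open>B\<close>.\<close>
  have "darboux D b c L1 L"
    using symbol eqs(5) by (simp add: darboux_def)
  moreover have "b \<star>\<^bsub>D\<^esub> M = 1 + (- a) \<star>\<^bsub>D\<^esub> L" "c \<star>\<^bsub>D\<^esub> N = 1 + L \<star>\<^bsub>D\<^esub> (- a)"
      "M \<star>\<^bsub>D\<^esub> b = 1 + (- d) \<star>\<^bsub>D\<^esub> L1" "N \<star>\<^bsub>D\<^esub> c = 1 + L1 \<star>\<^bsub>D\<^esub> (- d)"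
    using eqs by (auto simp: pdo.mult_minus_left pdo.mult_minus_right algebra_simps)
  ultimately show ?thesis
    unfolding darboux_invertible_def by blast
qed

end
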